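(* Let $D$ be a (nonempty) finite set of positive integers with largest element $\|D\|$. If there is an integer $m>\|D\|$ such that the germ-maximal $D$-avoiding bit string $R$ of length $m$ is repeatable, then the infinite string $RRR\cdots$ obtained by repeating this string is the winner for $D$. In particular, the winner for $D$ exists and is periodic.
   Context: $\mathbb{N}=\{0,1,2,\dots\}$. For $S\subseteq\mathbb{N}$ put $S_q=\sum_{n\in S}q^n$ for $q\in(0,1)$. For $S,S'\subseteq\mathbb{N}$ write $S'\preceq S$ (the germ order; "$S$ dominates $S'$") iff there exists $\epsilon>0$ such that $S'_q\le S_q$ for all $q\in(1-\epsilon,1)$; this is a partial order on subsets of $\mathbb{N}$, and it is total on finite subsets. A set $S\subseteq\mathbb{N}$ is $D$-avoiding if no two elements of $S$ differ by an element of $D$. A $D$-avoiding set $S$ is the winner for $D$ if $S'\preceq S$ for every $D$-avoiding set $S'\subseteq\mathbb{N}$. Finite or infinite bit strings $b_0b_1b_2\cdots$ are identified with the sets $\{n: b_n=1\}$, so the germ order and the term "$D$-avoiding" apply to bit strings. The germ-maximal $D$-avoiding string of length $m$ is the (unique) maximum, in the germ order, of the finite set of $D$-avoiding bit strings of length $m$. Concatenation of strings is denoted by juxtaposition. A finite $D$-avoiding bit string $R$ of length greater than $\|D\|$ is called repeatable if the concatenation $RR$ is $D$-avoiding. A set $S\subseteq\mathbb{N}$ is periodic if there is $d\ge1$ such that for all $n\in\mathbb{N}$, $n\in S$ iff $n+d\in S$. *)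

theory Defs
  imports "HOL-Analysis.Analysis"
begin

definition qsum :: "nat set \<Rightarrow> real \<Rightarrow> real"
  where "qsum S q = (\<Sum>\<^sub>\<infinity>n\<in>S. q ^ n)"

(* An \<epsilon> greater than 1 would admit q outside (0,1), where the series need not converge, but any
   witness \<epsilon> may be replaced by a smaller positive one. *)
definition germ_le :: "nat set \<Rightarrow> nat set \<Rightarrow> bool"
  where "germ_le S' S \<longleftrightarrow> (\<exists>\<epsilon>>0. \<forall>q\<in>{1 - \<epsilon><..<1}. qsum S' q \<le> qsum S q)"

definition avoiding :: "nat set \<Rightarrow> nat set \<Rightarrow> bool"
  where "avoiding D S \<longleftrightarrow> (\<forall>x\<in>S. \<forall>y\<in>S. x < y \<longrightarrow> y - x \<notin> D)"

definition is_winner :: "nat set \<Rightarrow> nat set \<Rightarrow> bool"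
  where "is_winner D S \<longleftrightarrow> avoiding D S \<and> (\<forall>S'. avoiding D S' \<longrightarrow> germ_le S' S)"

(* Finite bit strings are Boolean lists; positions are counted from 0. *)
definition bits :: "bool list \<Rightarrow> nat set"
  where "bits R = {n. n < length R \<and> R ! n}"

definition is_germ_maximal :: "nat set \<Rightarrow> nat \<Rightarrow> bool list \<Rightarrow> bool"
  where "is_germ_maximal D m R \<longleftrightarrow>
    length R = m \<and> avoiding D (bits R) \<and>
    (\<forall>R'. length R' = m \<and> avoiding D (bits R') \<longrightarrow> germ_le (bits R') (bits R))"

definition repeatable :: "nat set \<Rightarrow> bool list \<Rightarrow> bool"
  where "repeatable D R \<longleftrightarrow>
    avoiding D (bits R) \<and> length R > Max D \<and> avoiding D (bits (R @ R))"

(* The set of the infinite string RRR..., for nonempty R. *)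
definition repeat_bits :: "bool list \<Rightarrow> nat set"
  where "repeat_bits R = {n. R ! (n mod length R)}"

definition periodic :: "nat set \<Rightarrow> bool"
  where "periodic S \<longleftrightarrow> (\<exists>d\<ge>1. \<forall>n. n \<in> S \<longleftrightarrow> n + d \<in> S)"

end

theory Submission
  imports Defs
begin

text \<open>
  The idea is to compare two infinite strings one block of length \<open>m\<close> at a time. If \<open>S\<^sub>k\<close> is the
  \<open>k\<close>-th block of \<open>S\<close>, shifted back to the origin, then \<open>S\<^sub>q = (\<Sum>k. q\<^bsup>mk\<^esup> (S\<^sub>k)\<^sub>q)\<close> for
  \<open>0 < q < 1\<close> (\<open>qsum_blocks\<close>). Each block of a \<open>D\<close>-avoiding set is itself a \<open>D\<close>-avoiding string of
  length \<open>m\<close>, hence is dominated by \<open>R\<close> for all \<open>q\<close> close enough to \<open>1\<close>. How close depends on the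
  block, but there are only finitely many strings of length \<open>m\<close>, so one threshold serves all blocks
  simultaneously (\<open>eventually_all_blocks_le\<close>). Beyond it the sum for \<open>S\<close> is bounded term by term by
  the sum for \<open>RRR\<dots>\<close>. That \<open>RRR\<dots>\<close> is \<open>D\<close>-avoiding follows from repeatability: positions whose
  difference lies in \<open>D\<close> are less than \<open>m\<close> apart, so they lie within two consecutive copies of \<open>R\<close>.

  The same comparison gives uniqueness. If \<open>S\<close> is also a winner, the two series agree for \<open>q\<close> near
  \<open>1\<close>, although one bounds the other term by term; hence all terms agree. So each block of \<open>S\<close> has
  the same polynomial as \<open>R\<close> on an interval, and therefore equals \<open>R\<close>.
\<close>

section \<open>The germ order as a statement about left neighbourhoods of 1\<close>

lemma germ_le_iff_eventually:
  "germ_le A B \<longleftrightarrow> (\<forall>\<^sub>F q in at_left 1. qsum A q \<le> qsum B q)"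
proof
  assume "germ_le A B"
  then obtain \<epsilon> where "\<epsilon> > 0" "\<forall>q\<in>{1 - \<epsilon><..<1}. qsum A q \<le> qsum B q"
    unfolding germ_le_def by blast
  then show "\<forall>\<^sub>F q in at_left 1. qsum A q \<le> qsum B q"
    unfolding eventually_at_left_field by (intro exI[of _ "1 - \<epsilon>"]) auto
next
  assume "\<forall>\<^sub>F q in at_left 1. qsum A q \<le> qsum B q"
  then obtain b where "b < 1" "\<forall>q>b. q < 1 \<longrightarrow> qsum A q \<le> qsum B q"
    unfolding eventually_at_left_field by blast
  then show "germ_le A B"
    unfolding germ_le_def by (intro exI[of _ "1 - b"]) auto
qed

lemma eventually_at_left_1_in_unit_interval:
  "\<forall>\<^sub>F q :: real in at_left 1. 0 < q \<and> q < 1"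
  unfolding eventually_at_left_field by (intro exI[of _ 0]) auto

text \<open>On finite sets the sum is a polynomial, and a polynomial is determined by its values on any
  interval.\<close>

lemma finite_eq_if_eventually_qsum_eq:
  assumes "finite A" "finite B"
    and "\<forall>\<^sub>F q in at_left 1. qsum A q = qsum B q"
  shows "A = B"
proof -
  define p where "p C = (\<Sum>n\<in>C. monom (1::real) n)" for C
  have poly_p: "poly (p C) q = qsum C q" if "finite C" for C q
    using that by (simp add: p_def qsum_def poly_sum poly_monom)
  have coeff_p: "coeff (p C) i = of_bool (i \<in> C)" if "finite C" for C i
    using that by (simp add: p_def coeff_sum)
  obtain b where b: "b < 1" "\<And>q. b < q \<Longrightarrow> q < 1 \<Longrightarrow> qsum A q = qsum B q"
    using assms(3) unfolding eventually_at_left_field by blast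
  have "{b<..<1} \<subseteq> {q. poly (p A - p B) q = 0}"
    using b(2) assms(1,2) by (auto simp: poly_p)
  then have "infinite {q. poly (p A - p B) q = 0}"
    using b(1) infinite_Ioo finite_subset by blast
  then have "p A = p B"
    using poly_roots_finite[of "p A - p B"] by auto
  then have "i \<in> A \<longleftrightarrow> i \<in> B" for i
    using coeff_p[OF assms(1), of i] coeff_p[OF assms(2), of i] by (simp add: of_bool_eq_iff)
  then show ?thesis by auto
qed

section \<open>Decomposition into blocks\<close>

definition block :: "nat \<Rightarrow> nat set \<Rightarrow> nat \<Rightarrow> nat set"
  where "block m S k = {j. j < m \<and> k * m + j \<in> S}"

lemma block_subset: "block m S k \<subseteq> {..<m}"
  by (auto simp: block_def)

lemma finite_block: "finite (block m S k)"
  by (rule finite_subset[OF block_subset]) simp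

lemma eq_if_blocks_eq:
  assumes "m > 0" "\<And>k. block m S k = block m T k"
  shows "S = T"
proof -
  have "n \<in> U \<longleftrightarrow> n mod m \<in> block m U (n div m)" for n U
    using assms(1) by (simp add: block_def)
  then show ?thesis using assms(2) by blast
qed

lemma avoiding_block:
  assumes "avoiding D S"
  shows "avoiding D (block m S k)"
  unfolding avoiding_def
proof (intro ballI impI)
  fix x y assume "x \<in> block m S k" "y \<in> block m S k" "x < y"
  then have "(k * m + y) - (k * m + x) \<notin> D"
    using assms unfolding avoiding_def block_def by fastforce
  then show "y - x \<notin> D" by simp
qed

lemma qsum_sums:
  assumes "0 < q" "q < 1"
  shows "(\<lambda>n. of_bool (n \<in> S) * q ^ n) sums qsum S q"
proof -
  let ?f = "\<lambda>n. of_bool (n \<in> S) * q ^ n"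
  have "summable (\<lambda>n. norm (?f n))"
    by (rule summable_comparison_test'[OF summable_geometric[of q]]) (use assms in auto)
  then have has_sum: "(?f has_sum (\<Sum>n. ?f n)) UNIV"
    by (intro norm_summable_imp_has_sum summable_sums[OF summable_norm_cancel])
  have "infsum ?f UNIV = qsum S q"
    unfolding qsum_def by (rule infsum_cong_neutral) auto
  then show ?thesis
    using has_sum_imp_sums[OF has_sum] infsumI[OF has_sum] by simp
qed

lemma qsum_blocks:
  assumes "0 < q" "q < 1" "m > 0"
  shows "(\<lambda>k. q ^ (k * m) * qsum (block m S k) q) sums qsum S q"
proof -
  let ?f = "\<lambda>n. of_bool (n \<in> S) * q ^ n"
  have "sum ?f {k * m..<k * m + m} = q ^ (k * m) * qsum (block m S k) q" for k
  proof -
    have "sum ?f {k * m..<k * m + m} = (\<Sum>j<m. ?f (k * m + j))"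
      using sum.shift_bounds_nat_ivl[of ?f 0 "k * m" m]
      by (simp add: atLeast0LessThan add.commute)
    also have "\<dots> = (\<Sum>j\<in>block m S k. q ^ (k * m) * q ^ j)"
      by (rule sum.mono_neutral_cong_right) (auto simp: block_def power_add)
    also have "\<dots> = q ^ (k * m) * qsum (block m S k) q"
      using finite_block by (simp add: qsum_def sum_distrib_left)
    finally show ?thesis .
  qed
  then show ?thesis
    using sums_group[OF qsum_sums[OF assms(1,2), of S] assms(3)] by (simp only:)
qed

text \<open>The neighbourhood of \<open>1\<close> has to work for all blocks simultaneously: the quantifier over \<open>k\<close>
  stands inside.\<close>

lemma germ_le_blockwise:
  assumes "m > 0"
    and "\<forall>\<^sub>F q in at_left 1. \<forall>k. qsum (block m S k) q \<le> qsum (block m T k) q"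
  shows "germ_le S T"
  unfolding germ_le_iff_eventually
  using assms(2) eventually_at_left_1_in_unit_interval
proof eventually_elim
  case (elim q)
  show ?case
    by (rule sums_le[OF _ qsum_blocks[of q m] qsum_blocks[of q m]])
      (use elim assms(1) in \<open>auto intro: mult_left_mono\<close>)
qed

text \<open>A series that bounds another term by term and has no larger sum agrees with it in every
  term.\<close>

lemma eq_if_blockwise_le_and_germ_ge:
  assumes "m > 0"
    and "\<forall>\<^sub>F q in at_left 1. \<forall>k. qsum (block m S k) q \<le> qsum (block m T k) q"
    and "germ_le T S"
  shows "S = T"
proof (rule eq_if_blocks_eq[OF assms(1)])
  fix k
  have "\<forall>\<^sub>F q in at_left 1. qsum (block m S k) q = qsum (block m T k) q"
    using assms(2) assms(3)[unfolded germ_le_iff_eventually]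
      eventually_at_left_1_in_unit_interval
  proof eventually_elim
    case (elim q)
    let ?g = "\<lambda>k. q ^ (k * m) * qsum (block m T k) q - q ^ (k * m) * qsum (block m S k) q"
    have g: "?g sums (qsum T q - qsum S q)"
      using elim(3) assms(1) by (intro sums_diff qsum_blocks) auto
    have nonneg: "0 \<le> ?g i" for i
      using elim(1,3) by (simp add: mult_left_mono)
    have "suminf ?g \<le> 0"
      using g elim(2) sums_unique by fastforce
    then have "suminf ?g = 0"
      by (intro antisym suminf_nonneg sums_summable[OF g] nonneg)
    then have "\<forall>i. ?g i = 0"
      by (subst (asm) suminf_eq_zero_iff[OF sums_summable[OF g] nonneg])
    then have "?g k = 0" ..
    then show ?case using elim(3) by simp
  qed
  then show "block m S k = block m T k"
    by (rule finite_eq_if_eventually_qsum_eq[OF finite_block finite_block])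
qed

section \<open>Repeating the germ-maximal string\<close>

lemma germ_maximal_dominates:
  assumes "is_germ_maximal D m R" "avoiding D A" "A \<subseteq> {..<m}"
  shows "germ_le A (bits R)"
proof -
  let ?A = "map (\<lambda>n. n \<in> A) [0..<m]"
  have "bits ?A = A"
    using assms(3) by (auto simp: bits_def)
  then have "length ?A = m \<and> avoiding D (bits ?A)"
    using assms(2) by simp
  then have "germ_le (bits ?A) (bits R)"
    using assms(1) unfolding is_germ_maximal_def by blast
  then show ?thesis
    using \<open>bits ?A = A\<close> by simp
qed

lemma block_repeat_bits:
  "block (length R) (repeat_bits R) k = bits R"
  by (auto simp: block_def repeat_bits_def bits_def)

text \<open>An infinite set has infinitely many blocks, but they are drawn from the finitely many subsets of
  \<open>{..<m}\<close>, so the thresholds beyond which \<open>R\<close> dominates them have a maximum below \<open>1\<close>.\<close>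

lemma eventually_all_blocks_le:
  assumes "is_germ_maximal D m R" "avoiding D S"
  shows "\<forall>\<^sub>F q in at_left 1. \<forall>k. qsum (block m S k) q \<le> qsum (block m (repeat_bits R) k) q"
proof -
  have "\<forall>\<^sub>F q in at_left 1. \<forall>A\<in>{A \<in> Pow {..<m}. avoiding D A}. qsum A q \<le> qsum (bits R) q"
    using germ_maximal_dominates[OF assms(1)]
    by (intro eventually_ball_finite) (auto simp: germ_le_iff_eventually)
  then show ?thesis
  proof eventually_elim
    case (elim q)
    have "length R = m"
      using assms(1) by (simp add: is_germ_maximal_def)
    then have "block m (repeat_bits R) k = bits R" for k
      using block_repeat_bits by blast
    moreover have "block m S k \<in> {A \<in> Pow {..<m}. avoiding D A}" for k
      using avoiding_block[OF assms(2)] block_subset by blast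
    ultimately show ?case
      using elim by simp
  qed
qed

lemma avoiding_repeat_bits:
  assumes "finite D" "repeatable D R"
  shows "avoiding D (repeat_bits R)"
  unfolding avoiding_def
proof (intro ballI impI notI)
  fix x y
  assume xy: "x \<in> repeat_bits R" "y \<in> repeat_bits R" "x < y" and D: "y - x \<in> D"
  define m where "m = length R"
  have "y - x < m"
    using Max_ge[OF assms(1) D] assms(2) by (simp add: repeatable_def m_def)
  \<comment> \<open>Translate the pair by a multiple of \<open>m\<close> so that \<open>x\<close> lands in the first copy of \<open>R\<close>.\<close>
  define a where "a = x mod m"
  define b where "b = a + (y - x)"
  have "a < m"
    using \<open>y - x < m\<close> by (simp add: a_def)
  have "b mod m = y mod m"
    using \<open>x < y\<close> mod_add_left_eq[of x m "y - x"] unfolding a_def b_def by simp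
  moreover have "b < m + m"
    using \<open>a < m\<close> \<open>y - x < m\<close> by (simp add: b_def)
  moreover have "(R @ R) ! i = R ! (i mod m)" if "i < m + m" for i
    using that by (cases "i < m") (simp_all add: nth_append le_mod_geq m_def)
  ultimately have "b \<in> bits (R @ R)"
    using xy(2) by (simp add: bits_def repeat_bits_def m_def)
  moreover have "a \<in> bits (R @ R)"
    using xy(1) \<open>a < m\<close> by (simp add: bits_def repeat_bits_def nth_append a_def m_def)
  moreover have "a < b" "b - a = y - x"
    using \<open>x < y\<close> by (auto simp: b_def)
  ultimately show False
    using assms(2) D unfolding repeatable_def avoiding_def by metis
qed

lemma periodic_repeat_bits:
  assumes "R \<noteq> []"
  shows "periodic (repeat_bits R)"
  unfolding periodic_def using assms
  by (intro exI[of _ "length R"]) (auto simp: repeat_bits_def Suc_le_eq)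

theorem theorem3:
  fixes D :: "nat set" and m :: nat and R :: "bool list"
  assumes "finite D" and "D \<noteq> {}" and "\<forall>d\<in>D. d > 0"
    and "m > Max D"
    and "is_germ_maximal D m R"
    and "repeatable D R"
  shows "is_winner D (repeat_bits R) \<and>
    (\<exists>!S. is_winner D S) \<and> (\<forall>S. is_winner D S \<longrightarrow> periodic S)"
proof -
  have m: "m > 0" using assms(4) by simp
  note le = eventually_all_blocks_le[OF assms(5)]
  have winner: "is_winner D (repeat_bits R)"
    unfolding is_winner_def
    using avoiding_repeat_bits[OF assms(1,6)] germ_le_blockwise[OF m le] by blast
  have unique: "S = repeat_bits R" if "is_winner D S" for S
    using that winner eq_if_blockwise_le_and_germ_ge[OF m le]
    unfolding is_winner_def by blast
  have "R \<noteq> []"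
    using assms(5) m by (auto simp: is_germ_maximal_def)
  then show ?thesis
    using winner unique periodic_repeat_bits by blast
qed

end
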